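(* Let $w$ be an overlap-free binary word, and suppose $w = S_1 S_2 \cdots S_k$ where each $S_i$ is a square. Then $k + L(w) + R(w) \leq 9$.
   Context: A square is a word of the form $xx$ with $x$ a nonempty word. An overlap is a word of the form $axaxa$ where $a$ is a single letter and $x$ a possibly empty word; a word is overlap-free if none of its factors (contiguous subwords) is an overlap. For a binary word $w$, $L(w) = 1$ if there exists $a \in \{0,1\}$ such that $aw$ is overlap-free and $L(w) = 0$ otherwise; $R(w) = 1$ if there exists $a \in \{0,1\}$ such that $wa$ is overlap-free and $R(w) = 0$ otherwise. *)

theory Defs
  imports Main "HOL-Library.Sublist"
begin

text \<open>Binary words are lists over the two-letter type \<^typ>\<open>bool\<close> (\<^term>\<open>False\<close> for the
  letter 0, \<^term>\<open>True\<close> for the letter 1); factors are the contiguous sublists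
  \<^const>\<open>sublist\<close>.\<close>

definition is_square :: "'a list \<Rightarrow> bool" where
  "is_square u \<longleftrightarrow> (\<exists>x. x \<noteq> [] \<and> u = x @ x)"

definition is_overlap :: "'a list \<Rightarrow> bool" where
  "is_overlap u \<longleftrightarrow> (\<exists>a x. u = [a] @ x @ [a] @ x @ [a])"

definition overlap_free :: "'a list \<Rightarrow> bool" where
  "overlap_free w \<longleftrightarrow> (\<forall>u. sublist u w \<longrightarrow> \<not> is_overlap u)"

definition left_ext :: "bool list \<Rightarrow> nat" where
  "left_ext w = (if \<exists>a. overlap_free ([a] @ w) then 1 else 0)"

definition right_ext :: "bool list \<Rightarrow> nat" where
  "right_ext w = (if \<exists>a. overlap_free (w @ [a]) then 1 else 0)"

end

theory Submission
  imports Defs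
begin

text \<open>If \<open>w\<close> has no left extension, deleting \<open>S\<^sub>1\<close> lowers \<open>k\<close> by one but makes the remaining
  word left extendable, and symmetrically on the right; so it is enough to show \<open>k \<le> 7\<close> when both
  \<open>c w\<close> and \<open>w d\<close> are overlap-free. Then \<open>w\<close> has no factor \<open>aaa\<close> or \<open>aabaa\<close>, hence all its factors
  \<open>aa\<close> start at positions of the same parity. The \<open>S\<^sub>i\<close> all start at even positions. If the factors
  \<open>aa\<close> start at odd positions, all \<open>S\<^sub>i\<close> are images of squares under the Thue--Morse morphism \<open>\<mu>\<close>,
  and one descends to the preimage, which is again extendable on both sides. If they start at even
  positions, every \<open>S\<^sub>i\<close> is one of 00, 11, 010010, 101101, and a finite search shows that no
  overlap-free word consists of a letter followed by eight of these.\<close>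

section \<open>Overlaps by positions, and short forbidden factors\<close>

lemma overlap_free_sublist: "overlap_free w \<Longrightarrow> sublist u w \<Longrightarrow> overlap_free u"
  unfolding overlap_free_def using sublist_order.order.trans by blast

lemma overlap_free_append: "overlap_free (p @ u @ q) \<Longrightarrow> overlap_free u"
  by (erule overlap_free_sublist) (auto simp: sublist_def)

text \<open>A factor of length 2p + 1 with period p is an overlap: if no letters disagreed, its
  first letter and the next p - 1 letters would play the roles of a and x. The later arguments use
  this index form.\<close>

lemma overlap_free_nth:
  assumes "overlap_free w" and "0 < p" and "i + 2 * p < length w"
  shows "\<exists>j\<le>p. w ! (i + j) \<noteq> w ! (i + j + p)"
proof (rule ccontr)
  assume "\<not> ?thesis"
  then have eq: "w ! (i + j) = w ! (i + j + p)" if "j \<le> p" for j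
    using that by blast
  define u where "u = take (2 * p + 1) (drop i w)"
  define x where "x = take (p - 1) (drop (i + 1) w)"
  have len: "length u = 2 * p + 1" "length x = p - 1"
    using assms by (auto simp: u_def x_def)
  have "u = [w ! i] @ x @ [w ! i] @ x @ [w ! i]"
  proof (rule nth_equalityI)
    show "length u = length ([w ! i] @ x @ [w ! i] @ x @ [w ! i])"
      using len assms by simp
    fix k assume "k < length u"
    then have k: "k \<le> 2 * p" using len by simp
    have uk: "u ! k = w ! (i + k)"
      using k assms by (simp add: u_def)
    have xn: "x ! j = w ! (i + 1 + j)" if "j < p - 1" for j
      using that assms by (simp add: x_def)
    have e0: "w ! (i + p) = w ! i" "w ! (i + p + p) = w ! i"
      using eq[of 0] eq[of p] by simp_all
    consider "k = 0" | "0 < k" "k < p" | "k = p" | "p < k" "k < 2 * p" | "k = 2 * p"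
      using k by linarith
    then show "u ! k = ([w ! i] @ x @ [w ! i] @ x @ [w ! i]) ! k"
    proof cases
      case 4
      then obtain l where l: "k = p + Suc l" "Suc l < p"
        using less_imp_Suc_add[of p k] by auto
      have "w ! (i + k) = w ! (i + Suc l)"
        using eq[of "Suc l"] l by (simp add: ac_simps)
      then show ?thesis
        using uk xn[of l] len l by (auto simp: nth_append nth_Cons')
    next
      case 5
      then show ?thesis
        using uk e0 len assms by (auto simp: nth_append nth_Cons' mult_2 add.assoc)
    qed (use uk xn e0 len assms in \<open>auto simp: nth_append nth_Cons'\<close>)
  qed
  then have "is_overlap u" unfolding is_overlap_def by blast
  moreover have "sublist u w"
    unfolding u_def by (meson sublist_drop sublist_order.order.trans sublist_take)
  ultimately show False using assms(1) unfolding overlap_free_def by blast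
qed

lemma overlap_free_no_cube:
  assumes "overlap_free w" and "i + 2 < length w"
  shows "w ! i \<noteq> w ! (i + 1) \<or> w ! (i + 1) \<noteq> w ! (i + 2)"
proof -
  obtain j where "j \<le> 1" "w ! (i + j) \<noteq> w ! (i + j + 1)"
    using overlap_free_nth[of w 1 i] assms by auto
  moreover from this(1) have "j = 0 \<or> j = 1" by linarith
  ultimately show ?thesis by auto
qed

text \<open>By cube-freeness both neighbours of aabaa are b, and baabaab is an overlap of period 3.
  The index bounds ensure that both neighbours exist.\<close>

lemma overlap_free_no_aabaa:
  fixes z :: "bool list"
  assumes of: "overlap_free z" and i: "0 < i" "i + 5 < length z"
    and eq: "z ! i = z ! (i + 1)" "z ! (i + 3) = z ! i" "z ! (i + 4) = z ! i"
      "z ! (i + 2) \<noteq> z ! i"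
  shows False
proof -
  obtain h where h: "i = Suc h" using i(1) gr0_implies_Suc by blast
  have left: "z ! h \<noteq> z ! i" using overlap_free_no_cube[OF of, of h] i eq h by auto
  have right: "z ! (i + 5) \<noteq> z ! i" using overlap_free_no_cube[OF of, of "i + 3"] i eq by (auto simp: add.commute)
  obtain j where "j \<le> 3" "z ! (h + j) \<noteq> z ! (h + j + 3)"
    using overlap_free_nth[OF of, of 3 h] i h by auto
  moreover from this(1) have "j = 0 \<or> j = 1 \<or> j = 2 \<or> j = 3" by linarith
  ultimately show False using left right eq h by (elim disjE) (simp_all add: eval_nat_numeral)
qed

section \<open>Parity of the positions of factors aa\<close>

text \<open>The parity p is the one at which no factor aa starts. For binary words, p = 0 means that
  cutting at even positions leaves only two-letter blocks 01 and 10; for p = 1 such blocks straddle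
  the cuts.\<close>

definition differ_at_parity :: "nat \<Rightarrow> 'a list \<Rightarrow> bool" where
  "differ_at_parity p w \<longleftrightarrow> (\<forall>i. Suc i < length w \<longrightarrow> i mod 2 = p \<longrightarrow> w ! i \<noteq> w ! Suc i)"

lemma differ_at_parityD:
  "differ_at_parity p w \<Longrightarrow> Suc i < length w \<Longrightarrow> i mod 2 = p \<Longrightarrow> w ! i \<noteq> w ! Suc i"
  unfolding differ_at_parity_def by blast

text \<open>Take two equal adjacent pairs at the least odd distance m; all adjacent letters strictly
  between them differ. Now m = 1 gives a cube, m at least 5 gives ababa, and m = 3 gives aabaa,
  which is excluded once it has a letter on each side.\<close>

lemma extendable_differ_at_parity:
  fixes w :: "bool list"
  assumes ofc: "overlap_free (c # w)" and ofd: "overlap_free (w @ [d])" and ev: "even (length w)"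
  shows "differ_at_parity 0 w \<or> differ_at_parity 1 w"
proof (rule ccontr)
  assume neg: "\<not> ?thesis"
  have of: "overlap_free w" using overlap_free_append[of "[c]" w "[]"] ofc by simp
  define D where "D i \<longleftrightarrow> Suc i < length w \<and> w ! i = w ! Suc i" for i
  obtain i\<^sub>0 j\<^sub>0 where "D i\<^sub>0" "D j\<^sub>0" "even i\<^sub>0" "odd j\<^sub>0"
    using neg unfolding differ_at_parity_def D_def by (metis even_iff_mod_2_eq_zero odd_iff_mod_2_eq_one)
  then have "\<exists>m i. D i \<and> D (i + m) \<and> odd m"
  proof (cases "i\<^sub>0 < j\<^sub>0")
    case True
    then show ?thesis using \<open>D i\<^sub>0\<close> \<open>D j\<^sub>0\<close> \<open>even i\<^sub>0\<close> \<open>odd j\<^sub>0\<close>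
      by (intro exI[of _ "j\<^sub>0 - i\<^sub>0"] exI[of _ i\<^sub>0]) auto
  next
    case False
    then show ?thesis using \<open>D i\<^sub>0\<close> \<open>D j\<^sub>0\<close> \<open>even i\<^sub>0\<close> \<open>odd j\<^sub>0\<close>
      by (intro exI[of _ "i\<^sub>0 - j\<^sub>0"] exI[of _ j\<^sub>0]) auto
  qed
  then obtain m where m: "\<exists>i. D i \<and> D (i + m) \<and> odd m"
    and least: "\<And>m'. m' < m \<Longrightarrow> \<not> (\<exists>i. D i \<and> D (i + m') \<and> odd m')"
    using exists_least_iff[of "\<lambda>m. \<exists>i. D i \<and> D (i + m) \<and> odd m"] by blast
  from m obtain i where i: "D i" "D (i + m)" and om: "odd m" by blast
  \<comment> \<open>An equal pair at offset l splits m into l and m - l, one of which is odd and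
    smaller than m.\<close>
  have between: "w ! (i + l) \<noteq> w ! Suc (i + l)" if l: "0 < l" "l < m" for l
  proof
    assume "w ! (i + l) = w ! Suc (i + l)"
    then have D: "D (i + l)" using i(2) l unfolding D_def by simp
    show False
    proof (cases "odd l")
      case True
      then show False using least[OF l(2)] D i(1) by blast
    next
      case False
      then have "odd (m - l)" using om l by simp
      moreover have "D (i + l + (m - l))" using i(2) l by simp
      ultimately show False using least[of "m - l"] D l by force
    qed
  qed
  have len: "Suc (i + m) < length w" using i(2) D_def by blast
  have "m = 1 \<or> m = 3 \<or> 5 \<le> m" using om by presburger
  then consider "m = 1" | "m = 3" | "5 \<le> m" by blast
  then show False
  proof cases
    case 1
    then show False using overlap_free_no_cube[OF of, of i] i len unfolding D_def by simp
  next
    case 3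
    then have alt: "w ! (i + 1) \<noteq> w ! (i + 2)" "w ! (i + 2) \<noteq> w ! (i + 3)"
      "w ! (i + 3) \<noteq> w ! (i + 4)" "w ! (i + 4) \<noteq> w ! (i + 5)"
      using between[of 1] between[of 2] between[of 3] between[of 4] by (simp_all add: eval_nat_numeral)
    obtain j where "j \<le> 2" "w ! (i + 1 + j) \<noteq> w ! (i + 1 + j + 2)"
      using overlap_free_nth[OF of, of 2 "i + 1"] 3 len by auto
    moreover from this(1) have "j = 0 \<or> j = 1 \<or> j = 2" by linarith
    ultimately show False using alt by (auto simp: eval_nat_numeral)
  next
    case 2
    then have eq: "w ! i = w ! (i + 1)" "w ! (i + 3) = w ! i" "w ! (i + 4) = w ! i"
      "w ! (i + 2) \<noteq> w ! i"
      using between[of 1] between[of 2] i unfolding D_def by (auto simp: eval_nat_numeral)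
    \<comment> \<open>Even length rules out w = aabaa, so aabaa has a neighbour inside w on one
      side; c or d supplies the other.\<close>
    have "length w \<noteq> 5" using ev by auto
    then have "0 < i \<or> i + 5 < length w" using 2 len by auto
    then show False
    proof
      assume "i + 5 < length w"
      then show False using overlap_free_no_aabaa[OF ofc, of "Suc i"] eq by (simp add: add.commute)
    next
      assume "0 < i"
      then show False using overlap_free_no_aabaa[OF ofd, of i] eq 2 len
        by (simp add: nth_append)
    qed
  qed
qed

section \<open>Squares starting at even positions\<close>

lemma alternating_nth:
  fixes x :: "bool list"
  assumes "\<And>i. Suc i < length x \<Longrightarrow> x ! i \<noteq> x ! Suc i" and "i < length x"
  shows "x ! i = (x ! 0 = even i)"
  using assms(2)
proof (induction i)
  case (Suc i)
  then show ?case using assms(1)[of i] by auto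
qed simp

text \<open>The two copies of x are an odd distance apart, so the pair at offset i has parity p in
  one of them.\<close>

lemma odd_square_alternating:
  assumes w: "differ_at_parity p w" "w = u @ x @ x @ v" and "p < 2" "odd (length x)"
    and i: "Suc i < length x"
  shows "x ! i \<noteq> x ! Suc i"
proof -
  have 1: "w ! (length u + i) = x ! i" "w ! Suc (length u + i) = x ! Suc i"
    using i by (auto simp: w(2) nth_append)
  have 2: "w ! (length u + length x + i) = x ! i" "w ! Suc (length u + length x + i) = x ! Suc i"
    using i by (auto simp: w(2) nth_append)
  have "(length u + i) mod 2 = p \<or> (length u + length x + i) mod 2 = p"
    using assms(3,4) by presburger
  then show ?thesis
    using 1 2 i differ_at_parityD[OF w(1), of "length u + i"]
      differ_at_parityD[OF w(1), of "length u + length x + i"] w(2) by fastforce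
qed

text \<open>Otherwise x alternates and, having odd length, begins and ends with the same letter; the
  two copies then meet in an equal pair at an even position.\<close>

lemma square_even_half:
  fixes w :: "bool list"
  assumes w: "differ_at_parity 0 w" "w = u @ x @ x @ v" and u: "even (length u)" and x: "x \<noteq> []"
  shows "even (length x)"
proof (rule ccontr)
  assume odd: "odd (length x)"
  obtain n where n: "length x = Suc n" using x by (cases x) auto
  have e: "even n" using odd n by simp
  have "x ! n = x ! 0"
    using alternating_nth[OF odd_square_alternating[OF w _ odd], of n] e n by simp
  moreover have "w ! (length u + n) = x ! n" "w ! Suc (length u + n) = x ! 0"
    using n by (auto simp: w(2) nth_append)
  moreover have "(length u + n) mod 2 = 0" using u e by presburger
  ultimately show False
    using differ_at_parityD[OF w(1), of "length u + n"] w(2) n by simp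
qed

text \<open>A square whose halves have even length and whose blocks straddle the boundaries can be rotated
  by one letter in either direction inside \<open>w\<close>, so it would be part of an overlap unless it is all
  of \<open>w\<close>.\<close>

lemma square_odd_half:
  fixes w :: "bool list"
  assumes w: "differ_at_parity 1 w" "w = u @ x @ x @ v" and u: "even (length u)" and x: "x \<noteq> []"
    and of: "overlap_free w" and proper: "u \<noteq> [] \<or> v \<noteq> []"
  shows "odd (length x)"
proof
  assume ev: "even (length x)"
  let ?n = "length x"
  let ?o = "length u"
  obtain m where m: "?n = Suc m" using x by (cases x) auto
  have n: "0 < ?n" using m by simp
  have lw: "length w = ?o + ?n + ?n + length v" by (simp add: w(2))
  have at: "w ! (?o + i) = x ! i" "w ! (?o + ?n + i) = x ! i" if "i < ?n" for i
    using that by (auto simp: w(2) nth_append)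
  have "(?o + m) mod 2 = 1" using ev u m by presburger
  then have "w ! (?o + m) \<noteq> w ! Suc (?o + m)"
    using differ_at_parityD[OF w(1)] lw m by simp
  then have mid: "x ! m \<noteq> x ! 0"
    using at(1)[of m] at(2)[of 0] m by simp
  from proper show False
  proof
    assume "v \<noteq> []"
    then have len: "?o + 2 * ?n < length w" by (simp add: w(2))
    have "(?o + ?n + m) mod 2 = 1" using ev u m by presburger
    then have "w ! (?o + ?n + m) \<noteq> w ! Suc (?o + ?n + m)"
      using differ_at_parityD[OF w(1)] len m by simp
    \<comment> \<open>Over two letters, the first letter of x and the letter after the square agree,
      since both differ from the last letter of x. The period thus extends one letter beyond the
      square.\<close>
    then have eq: "w ! (?o + ?n) = w ! (?o + ?n + ?n)"
      using mid at(2)[of m] at(2)[of 0] m by simp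
    obtain j where j: "j \<le> ?n" "w ! (?o + j) \<noteq> w ! (?o + j + ?n)"
      using overlap_free_nth[OF of n len] by blast
    show False
    proof (cases "j = ?n")
      case True
      then show False using eq j by simp
    next
      case False
      then have "w ! (?o + j) = w ! (?o + ?n + j)" using at[of j] j(1) by simp
      then show False using j(2) by (simp add: ac_simps)
    qed
  next
    assume "u \<noteq> []"
    then obtain h where h: "?o = Suc h" by (cases u) auto
    have len: "h + 2 * ?n < length w" using h by (simp add: w(2))
    have "h mod 2 = 1" using h u by presburger
    then have "w ! h \<noteq> w ! Suc h"
      using differ_at_parityD[OF w(1), of h] len n by simp
    \<comment> \<open>Symmetrically, the letter before the square equals the last letter of
      x.\<close>
    then have wh: "w ! h = x ! m"
      using mid at(1)[of 0] n h by auto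
    obtain j where j: "j \<le> ?n" "w ! (h + j) \<noteq> w ! (h + j + ?n)"
      using overlap_free_nth[OF of n len] by blast
    show False
    proof (cases j)
      case 0
      then show False using j wh at(1)[of m] h m by simp
    next
      case (Suc i)
      then have "w ! (?o + i) = w ! (?o + ?n + i)" using at[of i] j(1) by simp
      moreover have "?o + i = h + j" "?o + ?n + i = h + j + ?n" using h Suc by simp_all
      ultimately show False using j(2) by metis
    qed
  qed
qed

section \<open>Finite search over products of four squares\<close>

text \<open>The squares xx with x alternating of length 1 or 3.\<close>

definition odd_squares :: "bool list list" where
  "odd_squares = [[False, False], [True, True],
    [False, True, False, False, True, False], [True, False, True, True, False, True]]"

text \<open>Here x alternates and has odd length, and length 5 or more would give it a prefix
  ababa.\<close>

lemma square_in_odd_squares: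
  fixes w :: "bool list"
  assumes w: "differ_at_parity 1 w" "w = u @ x @ x @ v" and u: "even (length u)" and x: "x \<noteq> []"
    and of: "overlap_free w" and proper: "u \<noteq> [] \<or> v \<noteq> []"
  shows "x @ x \<in> set odd_squares"
proof -
  have odd: "odd (length x)" using square_odd_half[OF assms] .
  have alt: "x ! i = (x ! 0 = even i)" if "i < length x" for i
    using alternating_nth[OF odd_square_alternating[OF w _ odd] that] by simp
  have "overlap_free x" using overlap_free_append[of u x "x @ v"] of w(2) by simp
  have "length x < 5"
  proof (rule ccontr)
    assume "\<not> length x < 5"
    then obtain j where "j \<le> 2" "x ! (0 + j) \<noteq> x ! (0 + j + 2)"
      using overlap_free_nth[OF \<open>overlap_free x\<close>, of 2 0] by auto
    then show False
      using \<open>\<not> length x < 5\<close> alt[of j] alt[of "j + 2"] by auto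
  qed
  then have "length x = 1 \<or> length x = 3" using odd by presburger
  then consider "length x = 1" | "length x = 3" by blast
  then show ?thesis
  proof cases
    case 1
    then obtain a where "x = [a]" by (auto simp: length_Suc_conv)
    then show ?thesis by (cases a) (auto simp: odd_squares_def)
  next
    case 2
    then obtain a b c where "x = [a, b, c]" by (auto simp: length_Suc_conv numeral_3_eq_3)
    then show ?thesis using alt[of 1] alt[of 2] by (cases a) (auto simp: odd_squares_def)
  qed
qed

text \<open>Executable form of having an overlap as a prefix: letters 0 to p are compared with
  letters p to 2p, over a finite range of periods.\<close>

definition prefix_overlap :: "'a list \<Rightarrow> bool" where
  "prefix_overlap v \<longleftrightarrow>
    (\<exists>p \<in> set [1..<length v]. 2 * p < length v \<and> take (Suc p) v = take (Suc p) (drop p v))"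

fun overlap_check :: "'a list \<Rightarrow> bool" where
  "overlap_check [] \<longleftrightarrow> True"
| "overlap_check (a # w) \<longleftrightarrow> \<not> prefix_overlap (a # w) \<and> overlap_check w"

lemma overlap_free_not_prefix_overlap:
  assumes "overlap_free v"
  shows "\<not> prefix_overlap v"
proof
  assume "prefix_overlap v"
  then obtain p where p: "1 \<le> p" "2 * p < length v" "take (Suc p) v = take (Suc p) (drop p v)"
    unfolding prefix_overlap_def by auto
  obtain j where "j \<le> p" "v ! (0 + j) \<noteq> v ! (0 + j + p)"
    using overlap_free_nth[OF assms, of p 0] p by auto
  moreover have "take (Suc p) v ! j = take (Suc p) (drop p v) ! j" using p(3) by simp
  ultimately show False using p(2) by (simp add: add.commute)
qed

text \<open>This direction makes the search complete: filtering by \<open>overlap_check\<close>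
  discards no overlap-free word.\<close>

lemma overlap_free_check: "overlap_free w \<Longrightarrow> overlap_check w"
proof (induction w)
  case (Cons a w)
  then show ?case
    using overlap_free_not_prefix_overlap[of "a # w"] overlap_free_append[of "[a]" w "[]"] by simp
qed simp

text \<open>The starting letter stands for the left extension. Prefixes of overlap-free words are
  overlap-free, so pruning after each appended square loses none of them and keeps the search
  small.\<close>

fun odd_products :: "nat \<Rightarrow> bool list list" where
  "odd_products 0 = [[False], [True]]"
| "odd_products (Suc k) =
    filter overlap_check (concat (map (\<lambda>u. map (\<lambda>s. u @ s) odd_squares) (odd_products k)))"

lemma odd_products_complete:
  assumes "overlap_free (c # concat Ss)" and "set Ss \<subseteq> set odd_squares"
  shows "c # concat Ss \<in> set (odd_products (length Ss))"
  using assms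
proof (induction Ss rule: rev_induct)
  case (snoc S Ss)
  have "overlap_free (c # concat Ss)"
    using overlap_free_append[of "[]" "c # concat Ss" S] snoc.prems by simp
  then have *: "c # concat Ss \<in> set (odd_products (length Ss))" using snoc by simp
  have "S \<in> set odd_squares" using snoc.prems(2) by simp
  then have "(c # concat Ss) @ S \<in> (@) (c # concat Ss) ` set odd_squares" by (rule imageI)
  with * have "(c # concat Ss) @ S \<in> (\<Union>u \<in> set (odd_products (length Ss)). (@) u ` set odd_squares)"
    by (rule UN_I)
  then show ?case using overlap_free_check[OF snoc.prems(1)] by simp
qed auto

text \<open>This evaluation is the source of the bound 7.\<close>

lemma odd_products_8: "odd_products 8 = []"
  by code_simp

lemma odd_product_bound:
  assumes "overlap_free (c # concat Ss)" and "set Ss \<subseteq> set odd_squares"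
  shows "length Ss \<le> 7"
proof (rule ccontr)
  assume "\<not> length Ss \<le> 7"
  \<comment> \<open>The search is evaluated at eight squares, so a longer product is truncated to
    its first eight.\<close>
  then have len: "length (take 8 Ss) = 8" by simp
  have "overlap_free (c # concat (take 8 Ss))"
    using assms(1) overlap_free_append[of "[]" "c # concat (take 8 Ss)" "concat (drop 8 Ss)"]
    by (metis append_Cons append_Nil append_take_drop_id concat_append)
  then have "c # concat (take 8 Ss) \<in> set (odd_products 8)"
    using odd_products_complete[of c "take 8 Ss"] assms(2) len set_take_subset[of 8 Ss] by simp
  then show False using odd_products_8 by simp
qed

section \<open>Descent along the Thue-Morse morphism\<close>

fun thue_morse :: "bool list \<Rightarrow> bool list" where
  "thue_morse [] = []"
| "thue_morse (a # w) = a # (\<not> a) # thue_morse w"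

lemma thue_morse_append [simp]: "thue_morse (u @ v) = thue_morse u @ thue_morse v"
  by (induction u) auto

lemma length_thue_morse [simp]: "length (thue_morse w) = 2 * length w"
  by (induction w) auto

lemma thue_morse_concat: "thue_morse (concat Ts) = concat (map thue_morse Ts)"
  by (induction Ts) auto

lemma thue_morse_preimage:
  assumes "even (length w)" and "differ_at_parity 0 w"
  shows "\<exists>y. w = thue_morse y"
  using assms
proof (induction w rule: induct_list012)
  case (3 a b w)
  have "differ_at_parity 0 w"
    unfolding differ_at_parity_def
  proof (intro allI impI)
    fix i assume "Suc i < length w" "i mod 2 = 0"
    then show "w ! i \<noteq> w ! Suc i"
      using 3(4) unfolding differ_at_parity_def by (auto dest: spec[of _ "i + 2"])
  qed
  then obtain y where "w = thue_morse y" using 3 by auto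
  moreover have "b = (\<not> a)"
    using 3(4) unfolding differ_at_parity_def by (auto dest: spec[of _ 0])
  ultimately have "a # b # w = thue_morse (a # y)" by simp
  then show ?case by blast
qed (auto intro: exI[of _ "[]"])

text \<open>With b the complement of a, \<mu>(axaxa) without its first letter is bybyb for y =
  \<mu>(x)a, so an overlap survives. This suits the descent, where c supplies only the second letter
  of an image block.\<close>

lemma overlap_free_thue_morse_tl:
  assumes "overlap_free (tl (thue_morse w))"
  shows "overlap_free w"
  unfolding overlap_free_def
proof (intro allI impI notI)
  fix u assume "sublist u w" "is_overlap u"
  then obtain p q a x where w: "w = p @ ([a] @ x @ [a] @ x @ [a]) @ q"
    unfolding sublist_def is_overlap_def by blast
  let ?y = "thue_morse x @ [a]"
  let ?v = "[\<not> a] @ ?y @ [\<not> a] @ ?y @ [\<not> a]"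
  have "is_overlap ?v" unfolding is_overlap_def by blast
  moreover have "thue_morse w = (thue_morse p @ [a]) @ ?v @ thue_morse q"
    by (simp add: w)
  then have "tl (thue_morse w) = tl (thue_morse p @ [a]) @ ?v @ thue_morse q"
    by (metis append_is_Nil_conv not_Cons_self2 tl_append2)
  then have "sublist ?v (tl (thue_morse w))" unfolding sublist_def by blast
  ultimately show False using assms unfolding overlap_free_def by blast
qed

text \<open>Mirror case: without its last letter, \<mu>(axaxa) is ayaya for y = b\<mu>(x).\<close>

lemma overlap_free_thue_morse_butlast:
  assumes "overlap_free (butlast (thue_morse w))"
  shows "overlap_free w"
  unfolding overlap_free_def
proof (intro allI impI notI)
  fix u assume "sublist u w" "is_overlap u"
  then obtain p q a x where w: "w = p @ ([a] @ x @ [a] @ x @ [a]) @ q"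
    unfolding sublist_def is_overlap_def by blast
  let ?y = "[\<not> a] @ thue_morse x"
  let ?v = "[a] @ ?y @ [a] @ ?y @ [a]"
  have "is_overlap ?v" unfolding is_overlap_def by blast
  moreover have "thue_morse w = (thue_morse p @ ?v) @ ((\<not> a) # thue_morse q)"
    by (simp add: w)
  then have "butlast (thue_morse w) = (thue_morse p @ ?v) @ butlast ((\<not> a) # thue_morse q)"
    by (metis butlast_append list.distinct(1))
  then have "sublist ?v (butlast (thue_morse w))" unfolding sublist_def by auto
  ultimately show False using assms unfolding overlap_free_def by blast
qed

lemma even_length_concat_squares:
  "\<forall>S \<in> set Ss. is_square S \<Longrightarrow> even (length (concat Ss))"
  by (induction Ss) (auto simp: is_square_def)

text \<open>The half x has even length and starts at an even position, so the blocks 01 and 10 of w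
  cut it exactly.\<close>

lemma square_thue_morse_preimage:
  fixes w :: "bool list"
  assumes w: "differ_at_parity 0 w" "w = u @ S @ v" and u: "even (length u)" and S: "is_square S"
  shows "\<exists>T. is_square T \<and> S = thue_morse T"
proof -
  obtain x where x: "x \<noteq> []" "S = x @ x" using S unfolding is_square_def by blast
  have ev: "even (length x)"
    using square_even_half[OF w(1) _ u x(1), of v] w(2) x(2) by simp
  have "differ_at_parity 0 x"
    unfolding differ_at_parity_def
  proof (intro allI impI)
    fix i assume i: "Suc i < length x" "i mod 2 = 0"
    then have "w ! (length u + i) \<noteq> w ! Suc (length u + i)"
      using differ_at_parityD[OF w(1), of "length u + i"] arg_cong[OF w(2), of length] u x(2)
      by (simp add: mod_add_eq[of "length u" 2 i, symmetric] even_iff_mod_2_eq_zero)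
    then show "x ! i \<noteq> x ! Suc i" using i by (simp add: w(2) x(2) nth_append)
  qed
  then obtain y where y: "x = thue_morse y" using thue_morse_preimage ev by blast
  then have "S = thue_morse (y @ y)" "y \<noteq> []" using x by auto
  then show ?thesis unfolding is_square_def by blast
qed

section \<open>Words extendable on both sides\<close>

text \<open>Induction on the length of the product, with c general because the descent replaces it
  by its complement.\<close>

lemma extendable_square_product_bound:
  fixes Ss :: "bool list list"
  assumes "overlap_free (c # concat Ss)" and "overlap_free (concat Ss @ [d])"
    and "\<forall>S \<in> set Ss. is_square S"
  shows "length Ss \<le> 7"
  using assms
proof (induction "length (concat Ss)" arbitrary: c d Ss rule: less_induct)
  case less
  let ?w = "concat Ss"
  have of: "overlap_free ?w" using overlap_free_append[of "[c]" ?w "[]"] less.prems(1) by simp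
  \<comment> \<open>Squares have even length, so each factor starts at an even position; with at
    least two factors, none is the whole word.\<close>
  have split: "\<exists>u v. ?w = u @ S @ v \<and> even (length u) \<and> (2 \<le> length Ss \<longrightarrow> u \<noteq> [] \<or> v \<noteq> [])"
    if S: "S \<in> set Ss" for S
  proof -
    obtain us vs where Ss: "Ss = us @ S # vs" using split_list[OF S] by blast
    have ne: "concat ts \<noteq> []" if "ts \<noteq> []" "set ts \<subseteq> set Ss" for ts
      using that less.prems(3) by (cases ts) (auto simp: is_square_def)
    have "us \<noteq> [] \<or> vs \<noteq> []" if "2 \<le> length Ss" using that Ss by auto
    then have "2 \<le> length Ss \<longrightarrow> concat us \<noteq> [] \<or> concat vs \<noteq> []"
      using Ss ne[of us] ne[of vs] by auto
    moreover have "even (length (concat us))"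
      by (rule even_length_concat_squares) (use less.prems(3) Ss in simp)
    moreover have "?w = concat us @ S @ concat vs" using Ss by simp
    ultimately show ?thesis by blast
  qed
  show ?case
  proof (cases "2 \<le> length Ss")
    case True
    consider "differ_at_parity 0 ?w" | "differ_at_parity 1 ?w"
      using extendable_differ_at_parity[OF less.prems(1,2)] even_length_concat_squares[OF less.prems(3)]
      by blast
    then show ?thesis
    proof cases
      case 1
      then have "\<forall>S \<in> set Ss. \<exists>T. is_square T \<and> S = thue_morse T"
        using square_thue_morse_preimage split less.prems(3) by metis
      then obtain f where f: "\<forall>S \<in> set Ss. is_square (f S) \<and> S = thue_morse (f S)"
        by metis
      define Ts where "Ts = map f Ss"
      have "map thue_morse Ts = Ss" unfolding Ts_def using f by (simp add: map_idI)
      then have w: "?w = thue_morse (concat Ts)" by (simp add: thue_morse_concat)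
      have "Ss \<noteq> []" using True by auto
      then have "?w \<noteq> []" using less.prems(3) by (cases Ss) (auto simp: is_square_def)
      then have "length (concat Ts) < length ?w" using w by (cases "concat Ts") auto
      \<comment> \<open>The letter c is the second letter of the image of its complement, so the
        tail of the image is c followed by \<open>?w\<close>.\<close>
      moreover have "overlap_free ((\<not> c) # concat Ts)"
        using overlap_free_thue_morse_tl[of "(\<not> c) # concat Ts"] less.prems(1) w by simp
      \<comment> \<open>The letter d begins \<mu>(d), so on the right d itself extends the
        preimage.\<close>
      moreover have "overlap_free (concat Ts @ [d])"
        using overlap_free_thue_morse_butlast[of "concat Ts @ [d]"] less.prems(2) w
        by (simp add: butlast_append)
      moreover have "\<forall>T \<in> set Ts. is_square T" unfolding Ts_def using f by simp
      ultimately have "length Ts \<le> 7" using less.hyps by blast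
      then show ?thesis unfolding Ts_def by simp
    next
      case 2
      have "S \<in> set odd_squares" if S: "S \<in> set Ss" for S
      proof -
        obtain x where x: "x \<noteq> []" "S = x @ x"
          using less.prems(3) S unfolding is_square_def by blast
        obtain u v where "?w = u @ S @ v" "even (length u)" "u \<noteq> [] \<or> v \<noteq> []"
          using split[OF S] True by blast
        then show ?thesis using square_in_odd_squares[OF 2 _ _ x(1) of, of u v] x(2) by simp
      qed
      then show ?thesis using odd_product_bound[OF less.prems(1)] by blast
    qed
  qed simp
qed

section \<open>Trading end squares for extensions\<close>

theorem theorem8:
  fixes w :: "bool list" and Ss :: "bool list list"
  assumes "overlap_free w"
    and "w = concat Ss"
    and "\<forall>S \<in> set Ss. is_square S"
  shows "length Ss + left_ext w + right_ext w \<le> 9"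
proof (cases "2 \<le> length Ss")
  case False
  then show ?thesis by (simp add: left_ext_def right_ext_def)
next
  case True
  then obtain S Ts S' where Ss: "Ss = S # Ts @ [S']"
    by (cases Ss; cases "tl Ss" rule: rev_cases) auto
  \<comment> \<open>Once S is removed, its last letter c extends the rest on the left; likewise the
    first letter d of S' on the right.\<close>
  have "S \<noteq> []" "S' \<noteq> []" using assms(3) Ss by (auto simp: is_square_def)
  then obtain p c d q where S: "S = p @ [c]" and S': "S' = d # q"
    by (metis list.exhaust rev_exhaust)
  have w: "w = p @ [c] @ concat Ts @ [d] @ q" using assms(2) Ss S S' by simp
  have sq: "\<forall>S \<in> set (Ts @ [S']). is_square S" "\<forall>S \<in> set (S # Ts). is_square S"
    "\<forall>S \<in> set Ts. is_square S" using assms(3) Ss by auto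
  have inner_l: "overlap_free (c # concat Ts)"
    using overlap_free_append[of p "c # concat Ts" "[d] @ q"] assms(1) w by simp
  have inner_r: "overlap_free (concat Ts @ [d])"
    using overlap_free_append[of "p @ [c]" "concat Ts @ [d]" q] assms(1) w by simp
  have left: "overlap_free (c # concat (Ts @ [S']))"
    using overlap_free_append[of p "c # concat (Ts @ [S'])" "[]"] assms(1) w S' by simp
  have right: "overlap_free (concat (S # Ts) @ [d])"
    using overlap_free_append[of "[]" "concat (S # Ts) @ [d]" q] assms(1) w S by simp
  show ?thesis
  proof (cases "\<exists>a. overlap_free ([a] @ w)"; cases "\<exists>b. overlap_free (w @ [b])")
    assume "\<exists>a. overlap_free ([a] @ w)" "\<exists>b. overlap_free (w @ [b])"
    then have "length Ss \<le> 7"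
      using extendable_square_product_bound[of _ Ss] assms(2,3) by auto
    then show ?thesis by (simp add: left_ext_def right_ext_def)
  next
    assume *: "\<exists>a. overlap_free ([a] @ w)" "\<nexists>b. overlap_free (w @ [b])"
    then obtain a where "overlap_free (a # w)" by auto
    \<comment> \<open>Only S' is dropped: a remains a left extension, and d becomes a right one by
      \<open>right\<close>.\<close>
    then have "overlap_free (a # concat (S # Ts))"
      using overlap_free_append[of "[]" "a # concat (S # Ts)" S'] assms(2) Ss by simp
    then have "length (S # Ts) \<le> 7"
      using extendable_square_product_bound right sq(2) by blast
    then show ?thesis using * Ss by (simp add: left_ext_def right_ext_def)
  next
    assume *: "\<nexists>a. overlap_free ([a] @ w)" "\<exists>b. overlap_free (w @ [b])"
    then obtain b where "overlap_free (w @ [b])" by auto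
    then have "overlap_free (concat (Ts @ [S']) @ [b])"
      using overlap_free_append[of S "concat (Ts @ [S']) @ [b]" "[]"] assms(2) Ss by simp
    then have "length (Ts @ [S']) \<le> 7"
      using extendable_square_product_bound left sq(1) by blast
    then show ?thesis using * Ss by (simp add: left_ext_def right_ext_def)
  next
    assume *: "\<nexists>a. overlap_free ([a] @ w)" "\<nexists>b. overlap_free (w @ [b])"
    have "length Ts \<le> 7"
      using extendable_square_product_bound inner_l inner_r sq(3) by blast
    then show ?thesis using * Ss by (simp add: left_ext_def right_ext_def)
  qed
qed

end
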